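(* Let $R$ be either a linear commutative, unitary ring, or an integral domain with unity that is embeddable into a field of characteristic zero. Let $n\in\mathbb{N}$ with $n\geq 1$ and let $A\colon R\to R$ be an additive mapping. Then $A\in\mathscr{D}_{n}(R)$ if and only if $$\sum_{i=0}^{n}(-1)^{i}\binom{n+1}{i}x^{i}A\left(x^{n+1-i}\right)=0$$ for all $x\in R$.
   Context: A commutative unitary ring $R$ is called linear if it is a linear space over the field $\mathbb{Q}$ of rationals. A mapping $f\colon R\to R$ is additive if $f(x+y)=f(x)+f(y)$ for all $x,y\in R$. Higher order derivations: let $R$ be a ring. The identically zero map is the only derivation of order zero. For each integer $n\ge 1$, an additive mapping $f\colon R\to R$ is a derivation of order $n$ if there exists $B\colon R\times R\to R$ such that $B$ is a bi-derivation of order $n-1$ (that is, $B$ is a derivation of order $n-1$ in each variable, the other variable being fixed) and $f(xy)-xf(y)-f(x)y=B(x,y)$ for all $x,y\in R$. The set of derivations of order $n$ of $R$ is denoted by $\mathscr{D}_{n}(R)$. Convention: $x^0=1$ for all $x\in R$. *)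

theory Defs
  imports Complex_Main "HOL-Algebra.Module"
begin

definition rat_ring :: "rat ring"
  where "rat_ring = \<lparr>carrier = UNIV, mult = (*), one = 1, zero = 0, add = (+)\<rparr>"

lemma field_rat_ring: "field rat_ring"
proof -
  have "cring rat_ring"
  proof (rule cringI)
    show "abelian_group rat_ring"
    proof (rule abelian_groupI)
      fix x assume "x \<in> carrier rat_ring"
      show "\<exists>y\<in>carrier rat_ring. y \<oplus>\<^bsub>rat_ring\<^esub> x = \<zero>\<^bsub>rat_ring\<^esub>"
        by (rule bexI[of _ "- x"]) (simp_all add: rat_ring_def)
    qed (simp_all add: rat_ring_def algebra_simps)
    show "comm_monoid rat_ring"
      by (rule comm_monoidI) (simp_all add: rat_ring_def algebra_simps)
  qed (simp_all add: rat_ring_def algebra_simps)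
  then show ?thesis
  proof (rule cring.cring_fieldI2)
    fix a assume "a \<in> carrier rat_ring" "a \<noteq> \<zero>\<^bsub>rat_ring\<^esub>"
    then show "\<exists>b\<in>carrier rat_ring. a \<otimes>\<^bsub>rat_ring\<^esub> b = \<one>\<^bsub>rat_ring\<^esub>"
      by (intro bexI[of _ "inverse a"]) (simp_all add: rat_ring_def)
  qed (simp add: rat_ring_def)
qed

text \<open>
  \<^term>\<open>module\<close> over the field of rationals means vector space. The scalar multiplication is not
  required to be compatible with the ring multiplication: the additive group of a rational vector
  space is uniquely divisible, so compatibility is automatic.
\<close>

definition linear_ring :: "('a, 'm) ring_scheme \<Rightarrow> bool"
  where "linear_ring R \<longleftrightarrow>
    (\<exists>scale :: rat \<Rightarrow> 'a \<Rightarrow> 'a.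
      module rat_ring
        \<lparr>carrier = carrier R, mult = mult R, one = one R, zero = zero R, add = add R,
         smult = scale\<rparr>)"

definition char_zero :: "('a, 'm) ring_scheme \<Rightarrow> bool"
  where "char_zero K \<longleftrightarrow> (\<forall>n::nat. n > 0 \<longrightarrow> [n] \<cdot>\<^bsub>K\<^esub> \<one>\<^bsub>K\<^esub> \<noteq> \<zero>\<^bsub>K\<^esub>)"

text \<open>
  Maps are only constrained on the carrier. The map \<open>B\<close> need not be assumed to send the carrier
  into itself: every derivation of any order does, and so does \<open>B\<close> in each variable.
\<close>

primrec derivation_of_order :: "('a, 'm) ring_scheme \<Rightarrow> nat \<Rightarrow> ('a \<Rightarrow> 'a) \<Rightarrow> bool"
  where
    "derivation_of_order R 0 f \<longleftrightarrow> (\<forall>x\<in>carrier R. f x = \<zero>\<^bsub>R\<^esub>)"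
  | "derivation_of_order R (Suc n) f \<longleftrightarrow>
      f \<in> hom (add_monoid R) (add_monoid R) \<and>
      (\<exists>B. (\<forall>y\<in>carrier R. derivation_of_order R n (\<lambda>x. B x y)) \<and>
           (\<forall>x\<in>carrier R. derivation_of_order R n (\<lambda>y. B x y)) \<and>
           (\<forall>x\<in>carrier R. \<forall>y\<in>carrier R.
              f (x \<otimes>\<^bsub>R\<^esub> y) \<ominus>\<^bsub>R\<^esub> x \<otimes>\<^bsub>R\<^esub> f y \<ominus>\<^bsub>R\<^esub> f x \<otimes>\<^bsub>R\<^esub> y = B x y))"

definition derivations :: "('a, 'm) ring_scheme \<Rightarrow> nat \<Rightarrow> ('a \<Rightarrow> 'a) set"
  where "derivations R n = {f. derivation_of_order R n f}"

end

theory Submission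
  imports Defs "HOL-Algebra.RingHom"
begin

text \<open>
  Let \<open>\<delta>\<^sub>x f\<close> be the commutator of \<open>f\<close> with multiplication by \<open>x\<close>. In any commutative ring, an additive
  \<open>f\<close> is a derivation of order \<open>n\<close> iff \<open>f(1) = 0\<close> and the symmetric multiadditive form
  \<open>(x0, \<dots>, xn) \<mapsto> (\<delta>\<^bsub>x0\<^esub> \<dots> \<delta>\<^bsub>xn\<^esub> f)(1)\<close> vanishes. Both kinds of ring in the theorem are
  torsion-free, so it suffices that the form vanishes on the diagonal. There, the binomial expansion
  of \<open>\<delta>\<^sub>x\<close> to the power \<open>n + 1\<close> gives the sum of the theorem plus the term \<open>\<plusminus>x^(n+1) f(1)\<close>, and taking
  \<open>x = 1\<close> shows that the vanishing of the sum forces \<open>f(1) = 0\<close>.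
\<close>

section \<open>Commutators with multiplication operators, and torsion-freeness\<close>

definition delta :: "('a, 'm) ring_scheme \<Rightarrow> 'a \<Rightarrow> ('a \<Rightarrow> 'a) \<Rightarrow> 'a \<Rightarrow> 'a"
  where "delta R x f = (\<lambda>y. f (x \<otimes>\<^bsub>R\<^esub> y) \<ominus>\<^bsub>R\<^esub> x \<otimes>\<^bsub>R\<^esub> f y)"

text \<open>The head of the list is the outermost commutator and the last entry the innermost. For
  additive maps the order of the entries does not affect the values on the carrier, see
  \<open>deltas_move\<close>.\<close>

definition deltas :: "('a, 'm) ring_scheme \<Rightarrow> 'a list \<Rightarrow> ('a \<Rightarrow> 'a) \<Rightarrow> 'a \<Rightarrow> 'a"
  where "deltas R xs f = foldr (delta R) xs f"

lemma deltas_Nil [simp]: "deltas R [] f = f"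
  and deltas_Cons [simp]: "deltas R (x # xs) f = delta R x (deltas R xs f)"
  and deltas_append: "deltas R (xs @ ys) f = deltas R xs (deltas R ys f)"
  by (simp_all add: deltas_def)

text \<open>The property shared by both kinds of ring. It constrains every element and not just the
  unit as \<open>char_zero\<close> does: with zero divisors, \<open>k 1 \<noteq> 0\<close> does not
  allow \<open>k\<close> to be cancelled, and the zero ring, which is linear, violates
  \<open>char_zero\<close>.\<close>

definition torsion_free :: "('a, 'm) ring_scheme \<Rightarrow> bool"
  where "torsion_free R \<longleftrightarrow>
    (\<forall>k::nat. \<forall>a\<in>carrier R. k > 0 \<longrightarrow> [k] \<cdot>\<^bsub>R\<^esub> a = \<zero>\<^bsub>R\<^esub> \<longrightarrow> a = \<zero>\<^bsub>R\<^esub>)"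

context cring
begin

section \<open>Binomial recursions and polynomials with coefficients in the ring\<close>

lemma add_pow_finsum:
  assumes "c \<in> I \<rightarrow> carrier R"
  shows "[(k::nat)] \<cdot> (\<Oplus>i\<in>I. c i) = (\<Oplus>i\<in>I. [k] \<cdot> c i)"
proof (induction k)
  case (Suc k)
  have "[Suc k] \<cdot> (\<Oplus>i\<in>I. c i) = (\<Oplus>i\<in>I. [k] \<cdot> c i) \<oplus> (\<Oplus>i\<in>I. c i)"
    using Suc by simp
  also have "\<dots> = (\<Oplus>i\<in>I. [k] \<cdot> c i \<oplus> c i)"
    using assms by (subst finsum_addf) (auto simp: Pi_iff)
  finally show ?case by simp
qed simp

text \<open>Each of the \<open>k\<close> unfoldings raises either \<open>p\<close> or
  \<open>q\<close>, and \<open>i\<close> counts how often \<open>q\<close> is chosen. This abstract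
  form of Pascal's rule serves both the expansion of a power of a commutator and the expansion of a
  multiadditive form at a sum.\<close>

lemma finsum_binomial:
  fixes S :: "nat \<Rightarrow> nat \<Rightarrow> nat \<Rightarrow> 'a"
  assumes closed: "\<And>k p q. S k p q \<in> carrier R"
    and step: "\<And>k p q. S (Suc k) p q = S k (Suc p) q \<oplus> S k p (Suc q)"
  shows "S k p q = (\<Oplus>i\<in>{..k}. [(k choose i)] \<cdot> S 0 (p + k - i) (q + i))"
proof (induction k arbitrary: p q)
  case 0
  then show ?case using closed by simp
next
  case (Suc k)
  define g where "g i = S 0 (p + Suc k - i) (q + i)" for i
  have g: "g i \<in> carrier R" for i by (simp add: g_def closed)
  have first: "S k (Suc p) q = (\<Oplus>i\<in>{..k}. [(k choose Suc i)] \<cdot> g (Suc i)) \<oplus> g 0"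
  proof -
    have "S k (Suc p) q = (\<Oplus>i\<in>{..k}. [(k choose i)] \<cdot> g i)"
      unfolding Suc.IH[of "Suc p" q] by (simp add: g_def)
    \<comment> \<open>The added term has coefficient \<open>k choose Suc k\<close>, which is 0. With
      the longer range, index 0 can be split off and the rest shifted by one to match Pascal's
      rule.\<close>
    also have "\<dots> = (\<Oplus>i\<in>{..Suc k}. [(k choose i)] \<cdot> g i)"
      using g by (subst finsum_Suc) (auto simp: binomial_eq_0)
    also have "\<dots> = (\<Oplus>i\<in>{..k}. [(k choose Suc i)] \<cdot> g (Suc i)) \<oplus> g 0"
      using g by (subst finsum_Suc2) auto
    finally show ?thesis .
  qed
  have second: "S k p (Suc q) = (\<Oplus>i\<in>{..k}. [(k choose i)] \<cdot> g (Suc i))"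
    unfolding Suc.IH[of p "Suc q"] by (simp add: g_def)
  have "(\<Oplus>i\<in>{..Suc k}. [(Suc k choose i)] \<cdot> g i)
      = (\<Oplus>i\<in>{..k}. [(k choose Suc i)] \<cdot> g (Suc i) \<oplus> [(k choose i)] \<cdot> g (Suc i)) \<oplus> g 0"
    using g by (subst finsum_Suc2) (auto simp: add.nat_pow_mult add.commute)
  also have "\<dots> = ((\<Oplus>i\<in>{..k}. [(k choose Suc i)] \<cdot> g (Suc i))
      \<oplus> (\<Oplus>i\<in>{..k}. [(k choose i)] \<cdot> g (Suc i))) \<oplus> g 0"
    using g by (subst finsum_addf) auto
  also have "\<dots> = S (Suc k) p q"
    unfolding step first second using g by (simp add: a_ac finsum_closed Pi_iff)
  finally show ?case by (simp add: g_def)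
qed

text \<open>A substitute for the Vandermonde determinant. Eliminating the top term multiplies each
  lower coefficient by a positive integer, which torsion-freeness cancels after the induction
  hypothesis has been applied.\<close>

lemma polynomial_vanishing:
  fixes c :: "nat \<Rightarrow> 'a"
  assumes tf: "torsion_free R" and c: "\<And>i. c i \<in> carrier R"
    and "\<And>t::nat. (\<Oplus>i\<in>{..d}. [(t ^ i)] \<cdot> c i) = \<zero>"
    and "i \<le> d"
  shows "c i = \<zero>"
  using c assms(3,4)
proof (induction d arbitrary: c i)
  case 0
  then show ?case by (auto dest: spec[of _ 0])
next
  case (Suc d)
  define c' where "c' i = [(2 ^ Suc d - 2 ^ i :: nat)] \<cdot> c i" for i
  have c': "c' i \<in> carrier R" for i using Suc.prems(1) by (simp add: c'_def)
  \<comment> \<open>The combination \<open>2\<^sup>d p(t) - p(2t)\<close> has no term of top degree.\<close>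
  have split: "[(2 ^ Suc d :: nat)] \<cdot> ([(t ^ i :: nat)] \<cdot> c i) =
      [((2 * t) ^ i)] \<cdot> c i \<oplus> [(t ^ i)] \<cdot> c' i" if "i \<le> Suc d" for t i
  proof -
    have "(2::nat) ^ i \<le> 2 ^ Suc d" using that by (intro power_increasing) auto
    then have "2 ^ Suc d * t ^ i = (2 * t) ^ i + t ^ i * (2 ^ Suc d - 2 ^ i)"
      by (simp add: power_mult_distrib algebra_simps flip: distrib_left)
    then show ?thesis
      using Suc.prems(1) by (simp add: c'_def add.nat_pow_pow add.nat_pow_mult mult.commute)
  qed
  have "(\<Oplus>i\<in>{..d}. [(t ^ i)] \<cdot> c' i) = \<zero>" for t :: nat
  proof -
    have "\<zero> = [(2 ^ Suc d :: nat)] \<cdot> (\<Oplus>i\<in>{..Suc d}. [(t ^ i)] \<cdot> c i)"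
      by (subst Suc.prems(2)) simp
    also have "\<dots> = (\<Oplus>i\<in>{..Suc d}. [(2 ^ Suc d :: nat)] \<cdot> ([(t ^ i)] \<cdot> c i))"
      using Suc.prems(1) by (intro add_pow_finsum) auto
    also have "\<dots> = (\<Oplus>i\<in>{..Suc d}. [((2 * t) ^ i)] \<cdot> c i \<oplus> [(t ^ i)] \<cdot> c' i)"
      using Suc.prems(1) c' by (intro finsum_cong' refl split) auto
    also have "\<dots> = (\<Oplus>i\<in>{..Suc d}. [((2 * t) ^ i)] \<cdot> c i) \<oplus> (\<Oplus>i\<in>{..Suc d}. [(t ^ i)] \<cdot> c' i)"
      using Suc.prems(1) c' by (intro finsum_addf) auto
    also have "\<dots> = (\<Oplus>i\<in>{..Suc d}. [(t ^ i)] \<cdot> c' i)"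
      \<comment> \<open>The first sum vanishes by the hypothesis at \<open>2 * t\<close>.\<close>
      using c' by (subst Suc.prems(2)) (simp add: finsum_closed Pi_iff del: finsum_Suc)
    also have "\<dots> = (\<Oplus>i\<in>{..d}. [(t ^ i)] \<cdot> c' i)"
      using c' by (subst finsum_Suc) (auto simp: c'_def finsum_closed Pi_iff)
    finally show ?thesis ..
  qed
  then have c'0: "c' i = \<zero>" if "i \<le> d" for i using Suc.IH[of c' i] c' that by blast
  have low: "c i = \<zero>" if "i \<le> d" for i
  proof -
    have "(2::nat) ^ i < 2 ^ Suc d" using that by (intro power_strict_increasing) auto
    then have "(0::nat) < 2 ^ Suc d - 2 ^ i" by linarith
    then show ?thesis
      using c'0[OF that] tf Suc.prems(1) unfolding c'_def torsion_free_def by blast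
  qed
  \<comment> \<open>The elimination lost the top coefficient; it is recovered from the value at
    \<open>t = 1\<close> now that all lower ones are zero.\<close>
  have "\<zero> = (\<Oplus>i\<in>{..Suc d}. [((1::nat) ^ i)] \<cdot> c i)" by (rule Suc.prems(2)[symmetric])
  also have "\<dots> = c (Suc d) \<oplus> (\<Oplus>i\<in>{..d}. [((1::nat) ^ i)] \<cdot> c i)"
    using Suc.prems(1) by (subst finsum_Suc) auto
  also have "(\<Oplus>i\<in>{..d}. [((1::nat) ^ i)] \<cdot> c i) = \<zero>"
    using low by (intro add.finprod_one_eqI) auto
  finally have "c (Suc d) = \<zero>" using Suc.prems(1) by simp
  with low Suc.prems(3) show ?case by (cases "i = Suc d") auto
qed

section \<open>Additive maps and the calculus of iterated commutators\<close>

abbreviation additive :: "('a \<Rightarrow> 'a) \<Rightarrow> bool"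
  where "additive f \<equiv> f \<in> hom (add_monoid R) (add_monoid R)"

lemma additive_closed: "additive f \<Longrightarrow> x \<in> carrier R \<Longrightarrow> f x \<in> carrier R"
  by (auto simp: hom_def)

lemma additive_add:
  "additive f \<Longrightarrow> x \<in> carrier R \<Longrightarrow> y \<in> carrier R \<Longrightarrow> f (x \<oplus> y) = f x \<oplus> f y"
  by (auto simp: hom_def)

lemma additiveI:
  assumes "\<And>x. x \<in> carrier R \<Longrightarrow> f x \<in> carrier R"
    and "\<And>x y. x \<in> carrier R \<Longrightarrow> y \<in> carrier R \<Longrightarrow> f (x \<oplus> y) = f x \<oplus> f y"
  shows "additive f"
  using assms by (auto simp: hom_def)

lemma additive_zero: "additive f \<Longrightarrow> f \<zero> = \<zero>"
  using additive_add[of f \<zero> \<zero>] additive_closed[of f \<zero>] by (metis add.l_cancel_one' zero_closed l_zero)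

lemma additive_delta:
  assumes "additive f" "x \<in> carrier R"
  shows "additive (delta R x f)"
  using assms
  by (intro additiveI)
    (auto simp: delta_def additive_closed additive_add r_distr minus_eq minus_add a_ac)

text \<open>Both sides expand to \<open>f(xyz) - x f(yz) - y f(xz) + xy f(z)\<close>, which is
  symmetric in \<open>x\<close> and \<open>y\<close>.\<close>

lemma delta_commute:
  assumes "additive f" "x \<in> carrier R" "y \<in> carrier R" "z \<in> carrier R"
  shows "delta R x (delta R y f) z = delta R y (delta R x f) z"
proof -
  have "f (x \<otimes> (y \<otimes> z)) = f (y \<otimes> (x \<otimes> z))" using assms by (simp add: m_lcomm)
  moreover have "x \<otimes> (y \<otimes> f z) = y \<otimes> (x \<otimes> f z)"
    using assms by (simp add: m_lcomm additive_closed)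
  ultimately show ?thesis
    using assms
    by (simp add: delta_def additive_closed minus_eq r_distr minus_add r_minus a_ac)
qed

lemma delta_cong:
  assumes "\<And>y. y \<in> carrier R \<Longrightarrow> f y = g y" "x \<in> carrier R" "z \<in> carrier R"
  shows "delta R x f z = delta R x g z"
  using assms by (simp add: delta_def)

lemma deltas_cong:
  assumes "\<And>y. y \<in> carrier R \<Longrightarrow> f y = g y" "set xs \<subseteq> carrier R" "z \<in> carrier R"
  shows "deltas R xs f z = deltas R xs g z"
  using assms(2,3)
proof (induction xs arbitrary: z)
  case (Cons x xs)
  then show ?case by (auto intro!: delta_cong)
qed (use assms(1) in simp)

lemma additive_deltas:
  assumes "additive f" "set xs \<subseteq> carrier R"
  shows "additive (deltas R xs f)"
  using assms by (induction xs) (auto intro: additive_delta)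

lemma deltas_closed:
  assumes "additive f" "set xs \<subseteq> carrier R" "z \<in> carrier R"
  shows "deltas R xs f z \<in> carrier R"
  using additive_closed[OF additive_deltas] assms by blast

lemma deltas_move:
  assumes "additive f" "x \<in> carrier R" "set xs \<subseteq> carrier R" "set ys \<subseteq> carrier R" "z \<in> carrier R"
  shows "deltas R (x # xs @ ys) f z = deltas R (xs @ x # ys) f z"
  using assms(3,5)
proof (induction xs arbitrary: z)
  case (Cons w xs)
  have "deltas R (x # (w # xs) @ ys) f z = delta R w (deltas R (x # xs @ ys) f) z"
    using Cons.prems assms by (auto intro!: delta_commute additive_deltas)
  also have "\<dots> = delta R w (deltas R (xs @ x # ys) f) z"
    using Cons by (intro delta_cong) auto
  finally show ?case by simp
qed simp

text \<open>Combined with \<open>deltas_move\<close>, additivity in the outermost entry gives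
  additivity in every entry of the list.\<close>

lemma delta_add_left:
  assumes "additive f" "x \<in> carrier R" "y \<in> carrier R" "z \<in> carrier R"
  shows "delta R (x \<oplus> y) f z = delta R x f z \<oplus> delta R y f z"
  using assms by (simp add: delta_def l_distr additive_add additive_closed minus_eq minus_add a_ac)

lemma delta_add_pow_left:
  assumes "additive f" "x \<in> carrier R" "z \<in> carrier R"
  shows "delta R ([(t::nat)] \<cdot> x) f z = [t] \<cdot> delta R x f z"
proof (induction t)
  case 0
  then show ?case using assms by (simp add: delta_def additive_zero additive_closed minus_eq)
next
  case (Suc t)
  then show ?case using assms by (simp add: delta_add_left)
qed

text \<open>Multiplication by \<open>a\<close> commutes with multiplication by \<open>x\<close>, so
  a single commutator already removes it; hence the list has to be nonempty.\<close>

lemma deltas_translate: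
  assumes "additive f" "a \<in> carrier R" "set xs \<subseteq> carrier R" "xs \<noteq> []" "z \<in> carrier R"
  shows "deltas R xs (\<lambda>y. f y \<ominus> a \<otimes> y) z = deltas R xs f z"
proof -
  \<comment> \<open>The last entry is the innermost commutator, the first to meet the subtracted
    multiplication.\<close>
  obtain x ys where xs: "xs = ys @ [x]" using assms(4) by (metis rev_exhaust)
  have "delta R x (\<lambda>y. f y \<ominus> a \<otimes> y) y = delta R x f y" if "y \<in> carrier R" for y
  proof -
    have "x \<in> carrier R" using assms(3) xs by auto
    moreover have "f (x \<otimes> y) \<in> carrier R" "f y \<in> carrier R"
      using calculation assms(1) that by (auto intro: additive_closed)
    ultimately show ?thesis
      unfolding delta_def using assms(2) that by algebra
  qed
  then show ?thesis
    unfolding xs deltas_append using assms(3,5) xs by (auto intro: deltas_cong)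
qed

section \<open>Higher order derivations in terms of iterated commutators\<close>

text \<open>The map itself enters only the top level of the recursion, and only through its values
  on the carrier, so a case split suffices and the same \<open>B\<close> serves both maps.\<close>

lemma derivation_of_order_cong:
  assumes "\<And>x. x \<in> carrier R \<Longrightarrow> f x = g x"
  shows "derivation_of_order R n f \<longleftrightarrow> derivation_of_order R n g"
proof (cases n)
  case (Suc m)
  have "additive f \<longleftrightarrow> additive g" using assms by (auto simp: hom_def Pi_iff)
  then show ?thesis using assms by (simp add: Suc)
qed (use assms in simp)

text \<open>The defect is \<open>B(x, \<cdot>) = delta x f - f(x) \<cdot>\<close>, and every \<open>delta\<close> annihilates
  multiplication by \<open>f(x)\<close>; so one level of the recursion costs exactly one more \<open>delta\<close>.\<close>

lemma derivation_of_order_iff_deltas: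
  assumes "additive f"
  shows "derivation_of_order R n f \<longleftrightarrow>
    f \<one> = \<zero> \<and> (\<forall>xs. set xs \<subseteq> carrier R \<longrightarrow> length xs = Suc n \<longrightarrow> deltas R xs f \<one> = \<zero>)"
  using assms
proof (induction n arbitrary: f)
  case 0
  show ?case
  proof
    assume "derivation_of_order R 0 f"
    then show "f \<one> = \<zero> \<and> (\<forall>xs. set xs \<subseteq> carrier R \<longrightarrow> length xs = Suc 0 \<longrightarrow> deltas R xs f \<one> = \<zero>)"
      by (auto simp: length_Suc_conv delta_def minus_eq)
  next
    assume *: "f \<one> = \<zero> \<and> (\<forall>xs. set xs \<subseteq> carrier R \<longrightarrow> length xs = Suc 0 \<longrightarrow> deltas R xs f \<one> = \<zero>)"
    have "f x = \<zero>" if "x \<in> carrier R" for x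
    proof -
      \<comment> \<open>The left side is \<open>f(x) - x f(1)\<close>, which equals
        \<open>f(x)\<close> because \<open>f(1) = 0\<close>.\<close>
      have "deltas R [x] f \<one> = \<zero>" using * that by (metis length_Cons list.size(3) empty_set
        empty_subsetI insert_subset list.simps(15))
      then show ?thesis using * that 0 by (simp add: delta_def minus_eq additive_closed)
    qed
    then show "derivation_of_order R 0 f" by simp
  qed
next
  case (Suc n)
  \<comment> \<open>Any witness in the definition agrees with this map on the carrier, so the
    existential quantifier can be replaced by it.\<close>
  define B where "B x = (\<lambda>y. delta R x f y \<ominus> f x \<otimes> y)" for x
  have B: "f (x \<otimes> y) \<ominus> x \<otimes> f y \<ominus> f x \<otimes> y = B x y" for x y by (simp add: B_def delta_def)
  have sym: "B x y = B y x" if "x \<in> carrier R" "y \<in> carrier R" for x y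
    using that Suc.prems by (simp add: B_def delta_def minus_eq additive_closed m_comm a_ac)
  have additive_B: "additive (B x)" if "x \<in> carrier R" for x
    using that Suc.prems additive_delta[OF Suc.prems that]
    by (intro additiveI) (auto simp: B_def additive_closed additive_add r_distr minus_eq minus_add a_ac)
  have B1: "B x \<one> = \<ominus> (x \<otimes> f \<one>)" if "x \<in> carrier R" for x
    using that Suc.prems by (simp add: B_def delta_def minus_eq additive_closed a_ac r_neg r_neg1 r_neg2)
  \<comment> \<open>The entry \<open>x\<close> hidden in \<open>B x\<close> becomes the innermost
    commutator, which is why it is appended at the end.\<close>
  have deltas_B: "deltas R xs (B x) \<one> = deltas R (xs @ [x]) f \<one>"
    if "x \<in> carrier R" "set xs \<subseteq> carrier R" "xs \<noteq> []" for x xs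
    using deltas_translate[OF additive_delta[OF Suc.prems that(1)] additive_closed[OF Suc.prems that(1)] that(2,3)]
    by (simp add: deltas_append B_def)
  have "derivation_of_order R (Suc n) f \<longleftrightarrow> (\<forall>x\<in>carrier R. derivation_of_order R n (B x))"
  proof
    assume "derivation_of_order R (Suc n) f"
    then obtain B' where "\<forall>x\<in>carrier R. derivation_of_order R n (\<lambda>y. B' x y)"
      and "\<forall>x\<in>carrier R. \<forall>y\<in>carrier R. B x y = B' x y"
      by (auto simp: B)
    then show "\<forall>x\<in>carrier R. derivation_of_order R n (B x)"
      by (metis derivation_of_order_cong)
  next
    assume "\<forall>x\<in>carrier R. derivation_of_order R n (B x)"
    \<comment> \<open>The defect is symmetric because the ring is commutative, so the condition in
      the second variable carries over to the first.\<close>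
    moreover from this have "\<forall>y\<in>carrier R. derivation_of_order R n (\<lambda>x. B x y)"
      by (metis derivation_of_order_cong sym)
    ultimately show "derivation_of_order R (Suc n) f"
      using Suc.prems by (auto simp: B intro!: exI[of _ B])
  qed
  also have "\<dots> \<longleftrightarrow> (\<forall>x\<in>carrier R. B x \<one> = \<zero> \<and>
      (\<forall>xs. set xs \<subseteq> carrier R \<longrightarrow> length xs = Suc n \<longrightarrow> deltas R (xs @ [x]) f \<one> = \<zero>))"
    using Suc.IH[OF additive_B] deltas_B by (metis length_0_conv nat.distinct(1))
  also have "\<dots> \<longleftrightarrow> f \<one> = \<zero> \<and>
      (\<forall>xs. set xs \<subseteq> carrier R \<longrightarrow> length xs = Suc (Suc n) \<longrightarrow> deltas R xs f \<one> = \<zero>)"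
    (is "?L \<longleftrightarrow> ?R")
  proof
    assume L: ?L
    \<comment> \<open>The condition \<open>B x 1 = 0\<close> at \<open>x = 1\<close> isolates
      \<open>f(1)\<close>.\<close>
    then have "\<ominus> (\<one> \<otimes> f \<one>) = \<zero>" using B1[of \<one>] by auto
    then have "f \<one> = \<zero>" using additive_closed[OF Suc.prems, of \<one>]
      by (metis add.inv_eq_1_iff l_one one_closed)
    moreover have "deltas R xs f \<one> = \<zero>" if "set xs \<subseteq> carrier R" "length xs = Suc (Suc n)" for xs
      using L that by (cases xs rule: rev_cases) auto
    ultimately show ?R by blast
  next
    assume ?R
    then show ?L using B1 by auto
  qed
  finally show ?case .
qed

section \<open>Binomial expansion on the diagonal\<close>

text \<open>The commutator is the difference of the operators taking \<open>f\<close> to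
  \<open>f(x y)\<close> and to \<open>x f(y)\<close>. These two commute, so the binomial theorem
  expands its \<open>m\<close>-th power.\<close>

lemma deltas_replicate_eq_finsum:
  assumes "additive f" "x \<in> carrier R"
  shows "deltas R (replicate m x) f \<one> =
    (\<Oplus>i\<in>{..m}. [((- 1) ^ i * int (m choose i))] \<cdot> (x [^] i \<otimes> f (x [^] (m - i))))"
proof -
  \<comment> \<open>Here \<open>k\<close> commutators are still unexpanded, \<open>p\<close> factors
    \<open>x\<close> stand inside the argument, and \<open>q\<close> stand outside, each with a
    sign.\<close>
  define S where "S k p q = [((- 1) ^ q :: int)] \<cdot> (x [^] q \<otimes> deltas R (replicate k x) f (x [^] p))"
    for k p q :: nat
  have closed: "deltas R (replicate k x) f (x [^] p) \<in> carrier R" for k p :: nat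
    using assms by (intro deltas_closed) (auto simp: set_replicate_conv_if)
  have "S m 0 0 = (\<Oplus>i\<in>{..m}. [(m choose i)] \<cdot> S 0 (0 + m - i) (0 + i))"
  proof (rule finsum_binomial)
    show "S k p q \<in> carrier R" for k p q using assms closed by (simp add: S_def)
    show "S (Suc k) p q = S k (Suc p) q \<oplus> S k p (Suc q)" for k p q
    proof -
      let ?g = "deltas R (replicate k x) f"
      have "x [^] q \<otimes> delta R x ?g (x [^] p)
          = x [^] q \<otimes> ?g (x [^] Suc p) \<oplus> \<ominus> (x [^] Suc q \<otimes> ?g (x [^] p))"
        using assms closed[of k p] closed[of k "Suc p"]
        by (simp add: delta_def minus_eq r_distr r_minus m_ac)
      then show ?thesis
        using assms closed[of k p] closed[of k "Suc p"]
        by (simp add: S_def add.int_pow_distrib add.int_pow_neg add.int_pow_inv del: nat_pow_Suc)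
    qed
  qed
  also have "\<dots> = (\<Oplus>i\<in>{..m}. [((- 1) ^ i * int (m choose i))] \<cdot> (x [^] i \<otimes> f (x [^] (m - i))))"
  proof (intro finsum_cong' refl)
    fix i
    have "[(m choose i)] \<cdot> ([((- 1) ^ i :: int)] \<cdot> a) = [((- 1) ^ i * int (m choose i))] \<cdot> a"
      if "a \<in> carrier R" for a
      using add.int_pow_pow[OF that, of "int (m choose i)" "(- 1) ^ i"] by (simp add: add_pow_int_ge)
    then show "[(m choose i)] \<cdot> S 0 (0 + m - i) (0 + i) =
        [((- 1) ^ i * int (m choose i))] \<cdot> (x [^] i \<otimes> f (x [^] (m - i)))"
      using assms by (simp add: S_def additive_closed)
  qed (use assms in \<open>auto simp: additive_closed\<close>)
  finally show ?thesis
    using assms closed[of m 0] by (simp add: S_def)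
qed

section \<open>Polarization: from the diagonal to all arguments\<close>

text \<open>Putting \<open>x + t y\<close> into the \<open>d + 1\<close> equal slots gives a
  polynomial in the natural number \<open>t\<close> that vanishes identically. Its linear
  coefficient is \<open>d + 1\<close> times the value with one slot equal to \<open>y\<close>, and
  torsion-freeness cancels \<open>d + 1\<close>.\<close>

lemma deltas_polarization_step:
  assumes "torsion_free R" "additive f" "set zs \<subseteq> carrier R" "x \<in> carrier R" "y \<in> carrier R"
    and zero: "\<And>x. x \<in> carrier R \<Longrightarrow> deltas R (replicate (Suc d) x @ zs) f \<one> = \<zero>"
  shows "deltas R (replicate d x @ y # zs) f \<one> = \<zero>"
proof -
  define u where "u p q = deltas R (replicate p x @ replicate q y @ zs) f \<one>" for p q
  have closed: "deltas R xs f \<one> \<in> carrier R" if "set xs \<subseteq> carrier R" for xs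
    using assms(2) that by (intro deltas_closed) auto
  have u: "u p q \<in> carrier R" for p q
    unfolding u_def using assms by (intro closed) (auto simp: set_replicate_conv_if)
  have "(\<Oplus>i\<in>{..Suc d}. [(t ^ i)] \<cdot> ([(Suc d choose i)] \<cdot> u (Suc d - i) i)) = \<zero>" for t :: nat
  proof -
    define w where "w = x \<oplus> [t] \<cdot> y"
    have w: "w \<in> carrier R" using assms by (simp add: w_def)
    \<comment> \<open>Of the slots before \<open>zs\<close>, \<open>k\<close> still hold
      \<open>w\<close>, \<open>p\<close> hold \<open>x\<close> and \<open>q\<close> hold
      \<open>y\<close>; each choice of \<open>y\<close> contributes one factor
      \<open>t\<close>.\<close>
    define S where "S k p q =
        [(t ^ q)] \<cdot> deltas R (replicate k w @ replicate p x @ replicate q y @ zs) f \<one>" for k p q :: nat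
    have "S (Suc d) 0 0 = (\<Oplus>i\<in>{..Suc d}. [(Suc d choose i)] \<cdot> S 0 (0 + Suc d - i) (0 + i))"
    proof (rule finsum_binomial)
      show "S k p q \<in> carrier R" for k p q
        unfolding S_def using assms w
        by (intro add.nat_pow_closed closed) (auto simp: set_replicate_conv_if)
      show "S (Suc k) p q = S k (Suc p) q \<oplus> S k p (Suc q)" for k p q
      proof -
        let ?W = "replicate k w" and ?X = "replicate p x" and ?Y = "replicate q y"
        let ?L = "?W @ ?X @ ?Y @ zs"
        have sets: "set ?W \<subseteq> carrier R" "set (?X @ ?Y @ zs) \<subseteq> carrier R" "set ?L \<subseteq> carrier R"
          "set (?W @ ?X) \<subseteq> carrier R" "set (?Y @ zs) \<subseteq> carrier R"
          using assms w by (auto simp: set_replicate_conv_if)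
        have "deltas R (w # ?L) f \<one> = deltas R (x # ?L) f \<one> \<oplus> [t] \<cdot> deltas R (y # ?L) f \<one>"
          using assms additive_deltas[OF assms(2) sets(3)]
          by (simp add: w_def delta_add_left delta_add_pow_left)
        \<comment> \<open>Symmetry carries the new entry to the block of equal entries where it
          belongs.\<close>
        also have "deltas R (x # ?L) f \<one> = deltas R (?W @ replicate (Suc p) x @ ?Y @ zs) f \<one>"
          using deltas_move[OF assms(2,4) sets(1,2)] by simp
        also have "deltas R (y # ?L) f \<one> = deltas R (?W @ ?X @ replicate (Suc q) y @ zs) f \<one>"
          using deltas_move[OF assms(2,5) sets(4,5)] by simp
        finally have eq: "deltas R (replicate (Suc k) w @ ?X @ ?Y @ zs) f \<one>
          = deltas R (?W @ replicate (Suc p) x @ ?Y @ zs) f \<one>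
            \<oplus> [t] \<cdot> deltas R (?W @ ?X @ replicate (Suc q) y @ zs) f \<one>"
          by simp
        have c: "deltas R (?W @ replicate (Suc p) x @ ?Y @ zs) f \<one> \<in> carrier R"
          "deltas R (?W @ ?X @ replicate (Suc q) y @ zs) f \<one> \<in> carrier R"
          by (rule closed, use assms w in \<open>auto simp: set_replicate_conv_if\<close>)+
        show ?thesis
          unfolding S_def eq using c
          by (simp add: add.nat_pow_distrib add.nat_pow_pow mult.commute del: replicate_Suc)
      qed
    qed
    moreover have "S (Suc d) 0 0 = \<zero>" using zero[OF w] by (simp add: S_def)
    moreover have "(\<Oplus>i\<in>{..Suc d}. [(Suc d choose i)] \<cdot> S 0 (0 + Suc d - i) (0 + i))
        = (\<Oplus>i\<in>{..Suc d}. [(t ^ i)] \<cdot> ([(Suc d choose i)] \<cdot> u (Suc d - i) i))"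
      using u by (intro finsum_cong' refl)
        (auto simp: S_def add.nat_pow_pow mult.commute simp flip: u_def)
    ultimately show ?thesis by simp
  qed
  from polynomial_vanishing[OF assms(1) _ this, of 1]
  have "[(Suc d)] \<cdot> u d 1 = \<zero>" using u by simp
  then have "u d 1 = \<zero>" using assms(1) u unfolding torsion_free_def by blast
  then show ?thesis by (simp add: u_def)
qed

lemma deltas_polarization:
  assumes "torsion_free R" "additive f"
    and "\<And>x. x \<in> carrier R \<Longrightarrow> deltas R (replicate m x) f \<one> = \<zero>"
    and "set zs \<subseteq> carrier R" "length zs = m"
  shows "deltas R zs f \<one> = \<zero>"
proof -
  \<comment> \<open>This interpolates between the diagonal, at \<open>zs = []\<close>, and arbitrary
    arguments, at \<open>d = 0\<close>; each step trades one equal slot for a free one.\<close>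
  have "deltas R (replicate d x @ zs) f \<one> = \<zero>"
    if "d + length zs = m" "x \<in> carrier R" "set zs \<subseteq> carrier R" for d x zs
    using that
  proof (induction zs arbitrary: d x)
    case Nil
    then show ?case using assms(3) by simp
  next
    case (Cons z zs)
    then show ?case by (intro deltas_polarization_step[OF assms(1,2)]) auto
  qed
  from this[of 0 zs \<zero>] show ?thesis using assms(4,5) by simp
qed

section \<open>The criterion for torsion-free commutative rings\<close>

lemma derivation_of_order_iff_finsum:
  assumes "torsion_free R" "additive f"
  shows "derivation_of_order R n f \<longleftrightarrow> (\<forall>x\<in>carrier R.
    (\<Oplus>i\<in>{0..n}. [((- 1) ^ i * int ((n + 1) choose i))] \<cdot> (x [^] i \<otimes> f (x [^] (n + 1 - i)))) = \<zero>)"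
    (is "_ \<longleftrightarrow> (\<forall>x\<in>carrier R. ?s x = \<zero>)")
proof -
  have term_closed: "[((- 1) ^ i * int ((n + 1) choose i))] \<cdot> (x [^] i \<otimes> f (x [^] (n + 1 - i))) \<in> carrier R"
    if "x \<in> carrier R" for x i
    using that assms(2) by (simp add: additive_closed)
  have s_closed: "?s x \<in> carrier R" if "x \<in> carrier R" for x
    using term_closed[OF that] by (intro finsum_closed) blast
  \<comment> \<open>The expansion runs to \<open>i = n + 1\<close>, one index beyond the sum
    \<open>?s x\<close>; the extra term evaluates \<open>f\<close> at
    \<open>x^0 = 1\<close>.\<close>
  have full: "deltas R (replicate (Suc n) x) f \<one>
      = [((- 1) ^ Suc n :: int)] \<cdot> (x [^] Suc n \<otimes> f \<one>) \<oplus> ?s x" if "x \<in> carrier R" for x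
    using that assms(2) term_closed[OF that]
    by (subst deltas_replicate_eq_finsum[OF assms(2) that], subst finsum_Suc)
      (simp_all add: atLeast0AtMost del: nat_pow_Suc)
  show ?thesis
  proof
    assume "derivation_of_order R n f"
    then have "f \<one> = \<zero>" and "\<And>x. x \<in> carrier R \<Longrightarrow> deltas R (replicate (Suc n) x) f \<one> = \<zero>"
      unfolding derivation_of_order_iff_deltas[OF assms(2)]
      by (auto simp: set_replicate_conv_if simp del: replicate_Suc)
    then show "\<forall>x\<in>carrier R. ?s x = \<zero>"
      using full s_closed by (simp del: replicate_Suc nat_pow_Suc)
  next
    assume s: "\<forall>x\<in>carrier R. ?s x = \<zero>"
    \<comment> \<open>A commutator with multiplication by 1 is zero. At \<open>x = 1\<close> the
      expansion therefore leaves only the extra term, which is \<open>f(1)\<close> up to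
      sign.\<close>
    have "deltas R (replicate (Suc n) \<one>) f \<one> = \<zero>"
    proof -
      let ?g = "deltas R (replicate n \<one>) f"
      have "?g \<one> \<in> carrier R"
        using assms(2) by (intro deltas_closed) (auto simp: set_replicate_conv_if)
      then show ?thesis by (simp add: delta_def minus_eq r_neg)
    qed
    then have "[((- 1) ^ Suc n :: int)] \<cdot> (\<one> [^] Suc n \<otimes> f \<one>) = \<zero>"
      unfolding full[OF one_closed] bspec[OF s one_closed] using assms(2) by (simp add: additive_closed)
    then have "[((- 1) ^ Suc n :: int)] \<cdot> f \<one> = \<zero>"
      using assms(2) by (simp add: additive_closed del: power_Suc)
    then have f1: "f \<one> = \<zero>"
      using additive_closed[OF assms(2), of \<one>]
      by (cases "even (Suc n)") (simp_all add: add.int_pow_neg del: power_Suc)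
    then have "deltas R (replicate (Suc n) x) f \<one> = \<zero>" if "x \<in> carrier R" for x
      using full[OF that] s that by (simp del: replicate_Suc nat_pow_Suc)
    then show "derivation_of_order R n f"
      unfolding derivation_of_order_iff_deltas[OF assms(2)]
      using f1 deltas_polarization[OF assms] by blast
  qed
qed

end

section \<open>Torsion-freeness of the two kinds of ring\<close>

text \<open>Natural scalars act as repeated addition, by distributivity over the scalars, so scaling
  by \<open>1/k\<close> undoes the \<open>k\<close>-fold sum.\<close>

lemma torsion_free_linear_ring:
  fixes R :: "('a, 'm) ring_scheme"
  assumes "cring R" "linear_ring R"
  shows "torsion_free R"
proof -
  obtain scale :: "rat \<Rightarrow> 'a \<Rightarrow> 'a" where module: "module rat_ring
        \<lparr>carrier = carrier R, mult = mult R, one = one R, zero = zero R, add = add R,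
         smult = scale\<rparr>" (is "module _ ?M")
    using assms(2) unfolding linear_ring_def by blast
  interpret R: cring R by fact
  interpret M: module rat_ring ?M by (rule module)
  have scale_closed: "scale q a \<in> carrier R" if "a \<in> carrier R" for q a
    using M.smult_closed[of q a] that by (simp add: rat_ring_def)
  have scale_add: "scale (p + q) a = scale p a \<oplus>\<^bsub>R\<^esub> scale q a" if "a \<in> carrier R" for p q a
    using M.smult_l_distr[of p q a] that by (simp add: rat_ring_def)
  have scale_scale: "scale (p * q) a = scale p (scale q a)" if "a \<in> carrier R" for p q a
    using M.smult_assoc1[of p q a] that by (simp add: rat_ring_def)
  have scale_one: "scale 1 a = a" if "a \<in> carrier R" for a
    using M.smult_one[of a] that by (simp add: rat_ring_def)
  have scale_zero: "scale 0 a = \<zero>\<^bsub>R\<^esub>" if "a \<in> carrier R" for a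
    using M.smult_l_null[of a] that by (simp add: rat_ring_def)
  have scale_zero_right: "scale q \<zero>\<^bsub>R\<^esub> = \<zero>\<^bsub>R\<^esub>" for q
    using M.smult_r_null[of q] by (simp add: rat_ring_def)
  have scale_nat: "scale (of_nat k) a = [k] \<cdot>\<^bsub>R\<^esub> a" if "a \<in> carrier R" for k a
  proof (induction k)
    case 0
    then show ?case using that by (simp add: scale_zero)
  next
    case (Suc k)
    then show ?case
      using that scale_add[OF that, of "of_nat k" 1] by (simp add: scale_one algebra_simps)
  qed
  show ?thesis
    unfolding torsion_free_def
  proof (intro allI ballI impI)
    fix k :: nat and a assume a: "a \<in> carrier R" and k: "0 < k" and 0: "[k] \<cdot>\<^bsub>R\<^esub> a = \<zero>\<^bsub>R\<^esub>"
    have "a = scale (1 / of_nat k * of_nat k) a" using k a by (simp add: scale_one)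
    also have "\<dots> = scale (1 / of_nat k) ([k] \<cdot>\<^bsub>R\<^esub> a)" by (simp only: scale_scale[OF a] scale_nat[OF a])
    finally show "a = \<zero>\<^bsub>R\<^esub>" by (simp add: 0 scale_zero_right)
  qed
qed

text \<open>If \<open>k a = 0\<close>, then \<open>(k 1) h(a) = 0\<close> in \<open>K\<close>; as
  \<open>k 1\<close> is nonzero and \<open>K\<close> has no zero divisors, \<open>h(a) = 0\<close>,
  and injectivity of \<open>h\<close> gives \<open>a = 0\<close>.\<close>

lemma torsion_free_embeddable:
  fixes R :: "('a, 'm) ring_scheme" and K :: "('k, 'n) ring_scheme"
  assumes "ring R" "domain K" "char_zero K" "h \<in> ring_hom R K" "inj_on h (carrier R)"
  shows "torsion_free R"
proof -
  interpret R: ring R by fact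
  interpret K: domain K by fact
  interpret h: ring_hom_ring R K h
    by (rule ring_hom_ringI2) (use assms K.ring_axioms in auto)
  show ?thesis
    unfolding torsion_free_def
  proof (intro allI ballI impI)
    fix k :: nat and a assume a: "a \<in> carrier R" and k: "0 < k" and 0: "[k] \<cdot>\<^bsub>R\<^esub> a = \<zero>\<^bsub>R\<^esub>"
    have "h ([j] \<cdot>\<^bsub>R\<^esub> a) = [j] \<cdot>\<^bsub>K\<^esub> h a" for j :: nat
      using a by (induction j) auto
    then have "[k] \<cdot>\<^bsub>K\<^esub> h a = \<zero>\<^bsub>K\<^esub>" using 0 by (metis h.hom_zero)
    then have "([k] \<cdot>\<^bsub>K\<^esub> \<one>\<^bsub>K\<^esub>) \<otimes>\<^bsub>K\<^esub> h a = \<zero>\<^bsub>K\<^esub>"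
      using a by (simp add: K.add_pow_ldistr)
    moreover have "[k] \<cdot>\<^bsub>K\<^esub> \<one>\<^bsub>K\<^esub> \<noteq> \<zero>\<^bsub>K\<^esub>" using assms(3) k by (simp add: char_zero_def)
    ultimately have "h a = h \<zero>\<^bsub>R\<^esub>" using a K.integral by fastforce
    then show "a = \<zero>\<^bsub>R\<^esub>" by (rule inj_onD[OF assms(5) _ a R.zero_closed])
  qed
qed

theorem corollary2:
  fixes R :: "('a, 'm) ring_scheme" (structure)
    and n :: nat
    and A :: "'a \<Rightarrow> 'a"
  assumes "(cring R \<and> linear_ring R) \<or>
      (domain R \<and>
        (\<exists>(K :: 'k ring) h. field K \<and> char_zero K \<and> h \<in> ring_hom R K \<and> inj_on h (carrier R)))"
    and "n \<ge> 1"
    and "A \<in> hom (add_monoid R) (add_monoid R)"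
  shows "A \<in> derivations R n \<longleftrightarrow>
    (\<forall>x\<in>carrier R.
      (\<Oplus>i\<in>{0..n}. [((- 1) ^ i * int ((n + 1) choose i))] \<cdot> (x [^] i \<otimes> A (x [^] (n + 1 - i)))) = \<zero>)"
proof -
  from assms(1) have "cring R" by (auto dest: domain.axioms(1))
  moreover from assms(1) have "torsion_free R"
    by (auto intro: torsion_free_linear_ring torsion_free_embeddable
        dest: field.axioms(1) cring.axioms(1) domain.axioms(1))
  ultimately show ?thesis
    unfolding derivations_def mem_Collect_eq
    using assms(3) by (rule cring.derivation_of_order_iff_finsum)
qed

end
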